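(* A set $A\subseteq\{0,1\}^+$ has a maximal $\mathbf P$-slice if and only if it has a maximal $\mathbf P$-core.
   Context: A Turing machine $\Phi$ is a partial decision procedure for $A$ if for all $x\in\{0,1\}^+$: $\Phi(x)=1\Rightarrow x\in A$ and $\Phi(x)=0\Rightarrow x\notin A$; $\mathrm{dom}(\Phi)=\{x:\Phi(x)\in\{0,1\}\}$. A $\mathbf P$-approximation for $A$ is a partial decision procedure for $A$ that halts on all inputs in polynomial time. A set $S$ is a $\mathbf P$-slice for $A$ if $S=\mathrm{dom}(\Phi)$ for some $\mathbf P$-approximation $\Phi$ for $A$; it is maximal (up to finite variations) if $S'\setminus S$ is finite for every $\mathbf P$-slice $S'$ for $A$. A set $C$ is a $\mathbf P$-core for $A$ if $C\cap S$ is finite for every $\mathbf P$-slice $S$ for $A$; it is maximal (up to finite variations) if $C'\setminus C$ is finite for every $\mathbf P$-core $C'$ for $A$. *)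

theory Defs
  imports
    "HOL-Library.FuncSet"
    "HOL-Computational_Algebra.Polynomial"
begin

text \<open>
  Deterministic single-tape Turing machines over the input alphabet $\{0,1\}$, with a tape that is
  infinite to the right and an arbitrary finite tape alphabet.  A halting machine outputs
  \<open>Out1\<close>, \<open>Out0\<close>, or \<open>OutOther\<close>; the last one stands for every output outside $\{0,1\}$.
\<close>

datatype symbol = Blank | Bit bool | Aux nat

datatype move = MoveLeft | Stay | MoveRight

datatype verdict = Out1 | Out0 | OutOther

datatype control = Run nat | Halt verdict

record tm =
  states :: "nat set"
  alphabet :: "symbol set"
  start :: nat
  trans :: "nat \<times> symbol \<Rightarrow> control \<times> symbol \<times> move"

definition turing_machine :: "tm \<Rightarrow> bool" where
  "turing_machine M \<longleftrightarrow>
     finite (states M) \<and> start M \<in> states M \<and>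
     finite (alphabet M) \<and> {Blank, Bit False, Bit True} \<subseteq> alphabet M \<and>
     trans M \<in> states M \<times> alphabet M \<rightarrow>\<^sub>E
       (Run ` states M \<union> range Halt) \<times> alphabet M \<times> UNIV"

type_synonym config = "control \<times> nat \<times> (nat \<Rightarrow> symbol)"

text \<open>Moving left on the leftmost cell leaves the head there (truncated subtraction).\<close>

fun move_head :: "move \<Rightarrow> nat \<Rightarrow> nat" where
  "move_head MoveLeft i = i - 1"
| "move_head Stay i = i"
| "move_head MoveRight i = i + 1"

fun step :: "tm \<Rightarrow> config \<Rightarrow> config" where
  "step M (Run q, i, tape) =
     (case trans M (q, tape i) of (c, s, m) \<Rightarrow> (c, move_head m i, tape(i := s)))"
| "step M (Halt v, i, tape) = (Halt v, i, tape)"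

definition initial :: "tm \<Rightarrow> bool list \<Rightarrow> config" where
  "initial M x = (Run (start M), 0, \<lambda>i. if i < length x then Bit (x ! i) else Blank)"

text \<open>Halting configurations are fixed points of \<open>step\<close>, so being halted at time \<open>t\<close> means having
  halted after at most \<open>t\<close> steps.\<close>

definition halts_within :: "tm \<Rightarrow> bool list \<Rightarrow> nat \<Rightarrow> verdict \<Rightarrow> bool" where
  "halts_within M x t v \<longleftrightarrow> fst ((step M ^^ t) (initial M x)) = Halt v"

definition outputs :: "tm \<Rightarrow> bool list \<Rightarrow> verdict \<Rightarrow> bool" where
  "outputs M x v \<longleftrightarrow> (\<exists>t. halts_within M x t v)"

text \<open>The set $\{0,1\}^+$, with \<open>True\<close> for 1 and \<open>False\<close> for 0.\<close>

definition words :: "bool list set" where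
  "words = {x. x \<noteq> []}"

definition partial_decision_procedure :: "tm \<Rightarrow> bool list set \<Rightarrow> bool" where
  "partial_decision_procedure M A \<longleftrightarrow> turing_machine M \<and>
     (\<forall>x\<in>words. (outputs M x Out1 \<longrightarrow> x \<in> A) \<and> (outputs M x Out0 \<longrightarrow> x \<notin> A))"

definition tm_dom :: "tm \<Rightarrow> bool list set" where
  "tm_dom M = {x \<in> words. outputs M x Out1 \<or> outputs M x Out0}"

definition polynomial_time :: "tm \<Rightarrow> bool" where
  "polynomial_time M \<longleftrightarrow>
     (\<exists>p :: nat poly. \<forall>x\<in>words. \<exists>v. halts_within M x (poly p (length x)) v)"

definition P_approximation :: "tm \<Rightarrow> bool list set \<Rightarrow> bool" where
  "P_approximation M A \<longleftrightarrow> partial_decision_procedure M A \<and> polynomial_time M"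

definition P_slice :: "bool list set \<Rightarrow> bool list set \<Rightarrow> bool" where
  "P_slice A S \<longleftrightarrow> (\<exists>M. P_approximation M A \<and> S = tm_dom M)"

definition maximal_P_slice :: "bool list set \<Rightarrow> bool list set \<Rightarrow> bool" where
  "maximal_P_slice A S \<longleftrightarrow> P_slice A S \<and> (\<forall>S'. P_slice A S' \<longrightarrow> finite (S' - S))"

definition P_core :: "bool list set \<Rightarrow> bool list set \<Rightarrow> bool" where
  "P_core A C \<longleftrightarrow> C \<subseteq> words \<and> (\<forall>S. P_slice A S \<longrightarrow> finite (C \<inter> S))"

definition maximal_P_core :: "bool list set \<Rightarrow> bool list set \<Rightarrow> bool" where
  "maximal_P_core A C \<longleftrightarrow> P_core A C \<and> (\<forall>C'. P_core A C' \<longrightarrow> finite (C' - C))"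

end

theory Submission
  imports Defs "HOL-Library.Countable_Set"
begin

text \<open>
  The complement of a maximal slice is a maximal core.  Conversely, there are only countably many
  slices, and they are closed under union: run the first machine and, if it has no opinion,
  rewind the head and run the second machine on a fresh copy of the input kept on a second track.
  Let $T_n$ be the union of the first $n$ slices and $C$ a maximal core.  If no $T_n$
  is a maximal slice, then the complement of $C$ is not almost contained in any $T_n$, and picking
  new points outside $C \cup T_n$ for every $n$ yields an infinite core disjoint from $C$.
\<close>

section \<open>Families of sets modulo finite sets\<close>

text \<open>At stage \<open>n\<close> only finitely many values are taken, so the infinite set
  \<open>D n\<close> still holds a fresh one; well-founded recursion collects the choices.\<close>

lemma ex_injective_selector:
  fixes D :: "nat \<Rightarrow> 'a set"
  assumes "\<And>n. infinite (D n)"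
  obtains f where "inj f" "\<And>n. f n \<in> D n"
proof -
  have "\<exists>f. \<forall>n. f n \<in> D n \<and> f n \<notin> f ` {..<n}"
  proof (rule dependent_wellorder_choice)
    fix n and f :: "nat \<Rightarrow> 'a"
    have "infinite (D n - f ` {..<n})"
      using assms by simp
    then show "\<exists>r. r \<in> D n \<and> r \<notin> f ` {..<n}"
      by (metis Diff_iff ex_in_conv finite.emptyI)
  next
    fix r n and f g :: "nat \<Rightarrow> 'a"
    assume "\<And>y. y < n \<Longrightarrow> f y = g y"
    then have "f ` {..<n} = g ` {..<n}"
      by (intro image_cong) auto
    then show "(r \<in> D n \<and> r \<notin> f ` {..<n}) = (r \<in> D n \<and> r \<notin> g ` {..<n})"
      by simp
  qed
  then obtain f where f: "\<And>n. f n \<in> D n" "\<And>n. f n \<notin> f ` {..<n}"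
    by blast
  have "inj f"
    by (rule linorder_injI) (metis f(2) imageI lessThan_iff)
  with f(1) show ?thesis
    using that by blast
qed

text \<open>Isolates the combinatorics: with \<open>F\<close> the slices and \<open>W\<close> the
  words, orthogonal sets are the cores. What is left to show about machines is that their slices
  form a countable nonempty family closed under union.\<close>

lemma ex_almost_greatest_iff_ex_almost_greatest_orthogonal:
  fixes W :: "'a set" and F :: "'a set set"
  defines "orthogonal C \<equiv> C \<subseteq> W \<and> (\<forall>S\<in>F. finite (C \<inter> S))"
  assumes count: "countable F" and ne: "F \<noteq> {}" and sub: "\<And>S. S \<in> F \<Longrightarrow> S \<subseteq> W"
    and union: "\<And>S T. S \<in> F \<Longrightarrow> T \<in> F \<Longrightarrow> S \<union> T \<in> F"
  shows "(\<exists>S\<in>F. \<forall>S'\<in>F. finite (S' - S)) \<longleftrightarrow>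
    (\<exists>C. orthogonal C \<and> (\<forall>C'. orthogonal C' \<longrightarrow> finite (C' - C)))"
proof
  assume "\<exists>S\<in>F. \<forall>S'\<in>F. finite (S' - S)"
  then obtain S where S: "S \<in> F" "\<And>S'. S' \<in> F \<Longrightarrow> finite (S' - S)"
    by blast
  have "finite ((W - S) \<inter> S')" if "S' \<in> F" for S'
    by (rule finite_subset[OF _ S(2)[OF that]]) auto
  then have "orthogonal (W - S)"
    by (auto simp: orthogonal_def)
  moreover have "finite (C' - (W - S))" if "orthogonal C'" for C'
  proof (rule finite_subset)
    show "C' - (W - S) \<subseteq> C' \<inter> S" "finite (C' \<inter> S)"
      using that S(1) by (auto simp: orthogonal_def)
  qed
  ultimately show "\<exists>C. orthogonal C \<and> (\<forall>C'. orthogonal C' \<longrightarrow> finite (C' - C))"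
    by blast
next
  assume "\<exists>C. orthogonal C \<and> (\<forall>C'. orthogonal C' \<longrightarrow> finite (C' - C))"
  then obtain C where C: "orthogonal C" "\<And>C'. orthogonal C' \<Longrightarrow> finite (C' - C)"
    by blast
  define s where "s = from_nat_into F"
  have range_s: "range s = F"
    using count ne by (simp add: s_def)
  define T where "T n = (\<Union>k\<le>n. s k)" for n :: nat
  have T_in: "T n \<in> F" for n
  proof (induction n)
    case 0
    then show ?case using range_s by (auto simp: T_def)
  next
    case (Suc n)
    have "T (Suc n) = T n \<union> s (Suc n)"
      by (auto simp: T_def le_Suc_eq)
    then show ?case using Suc union range_s by auto
  qed
  have "\<exists>n. finite ((W - C) - T n)"
  proof (rule ccontr)
    assume "\<nexists>n. finite ((W - C) - T n)"
    then obtain f where f: "inj f" "\<And>n. f n \<in> (W - C) - T n"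
      using ex_injective_selector[of "\<lambda>n. (W - C) - T n"] by blast
    have "finite (range f \<inter> S)" if S: "S \<in> F" for S
    proof -
      obtain k where "S = s k"
        using S range_s by blast
      \<comment> \<open>Once \<open>k \<le> n\<close>, the set \<open>s k\<close> is contained in
        \<open>T n\<close>, which \<open>f n\<close> avoids; hence only the first \<open>k\<close>
        chosen points can lie in \<open>S\<close>.\<close>
      then have "f n \<notin> S" if "k \<le> n" for n
        using that f(2)[of n] by (auto simp: T_def)
      then have "range f \<inter> S \<subseteq> f ` {..<k}"
        by (force simp: not_less[symmetric])
      then show ?thesis
        using finite_surj by blast
    qed
    then have "orthogonal (range f)"
      using f(2) by (auto simp: orthogonal_def)
    then have "finite (range f - C)"
      by (rule C(2))
    moreover have "range f - C = range f"
      using f(2) by auto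
    ultimately show False
      using f(1) finite_imageD by fastforce
  qed
  then obtain n where n: "finite ((W - C) - T n)"
    by blast
  have "finite (S' - T n)" if "S' \<in> F" for S'
  proof (rule finite_subset)
    \<comment> \<open>Split \<open>S' - T n\<close> along \<open>C\<close>: the part inside
      \<open>C\<close> is finite by orthogonality, the rest lies in \<open>W - C\<close> because
      \<open>S' \<subseteq> W\<close>.\<close>
    show "S' - T n \<subseteq> (C \<inter> S') \<union> ((W - C) - T n)"
      using sub[OF that] by blast
    show "finite ((C \<inter> S') \<union> ((W - C) - T n))"
      using n C(1) that by (auto simp: orthogonal_def)
  qed
  then show "\<exists>S\<in>F. \<forall>S'\<in>F. finite (S' - S)"
    using T_in by blast
qed

section \<open>Countability of the set of Turing machines\<close>

instance symbol :: countable by countable_datatype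

text \<open>Transition functions are extensional, so fixing finite sets of states and symbols leaves
  finitely many of them; and there are countably many finite sets of naturals and of
  symbols.\<close>

lemma countable_turing_machines: "countable {M. turing_machine M}"
proof -
  define B :: "nat set \<times> symbol set \<Rightarrow> (nat \<times> symbol \<Rightarrow> control \<times> symbol \<times> move) set"
    where "B = (\<lambda>(Q, \<Gamma>). Q \<times> \<Gamma> \<rightarrow>\<^sub>E (Run ` Q \<union> range Halt) \<times> \<Gamma> \<times> UNIV)"
  define K where "K = (SIGMA p : {Q :: nat set. finite Q} \<times> {\<Gamma> :: symbol set. finite \<Gamma>}.
    (UNIV :: nat set) \<times> B p)"
  have "UNIV = {Out1, Out0, OutOther}" "UNIV = {MoveLeft, Stay, MoveRight}"
    using verdict.exhaust move.exhaust by blast+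
  then have fin: "finite (UNIV :: verdict set)" "finite (UNIV :: move set)"
    by (metis finite.simps)+
  have "countable (B p)" if "p \<in> {Q. finite Q} \<times> {\<Gamma>. finite \<Gamma>}" for p
    using that fin by (auto simp: B_def intro!: countable_finite finite_PiE)
  then have "countable K"
    unfolding K_def by (intro countable_SIGMA countable_Collect_finite) auto
  moreover define h where "h M = ((states M, alphabet M), start M, trans M)" for M :: tm
  have "h ` {M. turing_machine M} \<subseteq> K"
    by (auto simp: K_def B_def h_def turing_machine_def)
  ultimately have "countable (h ` {M. turing_machine M})"
    using countable_subset by blast
  moreover have "inj_on h {M. turing_machine M}"
    by (auto simp: inj_on_def h_def intro: tm.equality)
  ultimately show ?thesis
    by (simp add: countable_image_inj_eq)
qed

lemma countable_P_slices: "countable {S. P_slice A S}"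
proof (rule countable_subset)
  show "{S. P_slice A S} \<subseteq> tm_dom ` {M. turing_machine M}"
    by (auto simp: P_slice_def P_approximation_def partial_decision_procedure_def)
  show "countable (tm_dom ` {M. turing_machine M})"
    by (intro countable_image countable_turing_machines)
qed

section \<open>Runs of Turing machines\<close>

lemma trans_in:
  assumes "turing_machine L" "q \<in> states L" "a \<in> alphabet L"
  shows "trans L (q, a) \<in> (Run ` states L \<union> range Halt) \<times> alphabet L \<times> UNIV"
  using assms unfolding turing_machine_def by blast

lemma step_halted [simp]: "fst c = Halt v \<Longrightarrow> step M c = c"
  by (cases c rule: prod_cases3) auto

lemma steps_halted: "fst c = Halt v \<Longrightarrow> (step M ^^ t) c = c"
  by (induction t) auto

lemma halts_within_mono:
  assumes "halts_within M x t v" "t \<le> t'"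
  shows "halts_within M x t' v"
proof -
  have "(step M ^^ t') (initial M x) = (step M ^^ (t' - t)) ((step M ^^ t) (initial M x))"
    using assms(2) by (metis add.commute comp_apply funpow_add le_add_diff_inverse)
  then show ?thesis
    using assms(1) by (simp add: halts_within_def steps_halted)
qed

lemma halts_within_unique:
  assumes "halts_within M x t v" "halts_within M x t' v'"
  shows "v = v'"
  using halts_within_mono[OF assms(1), of "max t t'"] halts_within_mono[OF assms(2), of "max t t'"]
  by (simp add: halts_within_def)

lemma outputs_eqI:
  assumes "halts_within M x t v"
  shows "outputs M x v' \<longleftrightarrow> v' = v"
  using assms halts_within_unique unfolding outputs_def by blast

text \<open>Each step moves the head by at most one cell. This bounds the cost of rewinding by the
  running time of the first machine.\<close>

lemma head_le: "fst (snd ((step M ^^ t) c)) \<le> fst (snd c) + t"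
proof (induction t)
  case (Suc t)
  have "fst (snd (step M d)) \<le> fst (snd d) + 1" for d
  proof (cases d rule: prod_cases3)
    case (fields c i tp)
    then show ?thesis
    proof (cases c)
      case (Run q)
      have "move_head m i \<le> i + 1" for m
        by (cases m) auto
      then show ?thesis
        using fields Run by (auto split: prod.split)
    qed auto
  qed
  from this[of "(step M ^^ t) c"] Suc show ?case
    by simp
qed simp

text \<open>\<open>N\<close> may halt before time \<open>t\<close> and then stands still, whereas
  the simulating \<open>M\<close> may go on, for instance into the rewind. So \<open>M\<close> is
  stopped at a time \<open>t' \<le> t\<close>, and \<open>R\<close> has to be preserved only while
  \<open>N\<close> runs.\<close>

lemma simulation_until_halt:
  assumes sim: "\<And>c d q. R c d \<Longrightarrow> fst c = Run q \<Longrightarrow> R (step N c) (step M d)"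
    and "R c d" and "fst ((step N ^^ t) c) = Halt v"
  obtains t' where "t' \<le> t" "R ((step N ^^ t) c) ((step M ^^ t') d)"
proof -
  have "\<exists>t'\<le>t. R ((step N ^^ t) c) ((step M ^^ t') d)"
    using assms(2)
  proof (induction t arbitrary: c d)
    case 0
    then show ?case by simp
  next
    case (Suc t)
    show ?case
    proof (cases "fst c")
      case (Run q)
      then obtain t' where "t' \<le> t" "R ((step N ^^ t) (step N c)) ((step M ^^ t') (step M d))"
        using Suc sim by blast
      then have "Suc t' \<le> Suc t" "R ((step N ^^ Suc t) c) ((step M ^^ Suc t') d)"
        by (simp_all add: funpow_Suc_right del: funpow.simps)
      then show ?thesis by blast
    next
      case (Halt v)
      then have "R ((step N ^^ Suc t) c) ((step M ^^ 0) d)"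
        using Suc.prems steps_halted[OF Halt, where M = N and t = "Suc t"] by simp
      then show ?thesis by blast
    qed
  qed
  then show ?thesis using that by blast
qed

section \<open>Sequential composition on a two-track tape\<close>

text \<open>The constructors keep the states of the two machines apart; \<open>to_nat\<close> then
  turns phases into the natural numbers that \<open>tm\<close> demands.\<close>

datatype phase = Init | First nat | Rewind | Second nat

instance phase :: countable by countable_datatype

abbreviation phase_state :: "phase \<Rightarrow> control" where
  "phase_state p \<equiv> Run (to_nat p)"

text \<open>
  A cell is a mark, set exactly on the leftmost cell, together with the symbols of the first and
  the second track.  Symbols of the original input count as unmarked cells with this symbol on
  both tracks, so that no preprocessing pass over the input is needed.
\<close>

definition write_cell :: "bool \<times> symbol \<times> symbol \<Rightarrow> symbol" where
  "write_cell z = Aux (to_nat z)"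

fun read_cell :: "symbol \<Rightarrow> bool \<times> symbol \<times> symbol" where
  "read_cell (Aux n) = from_nat n"
| "read_cell s = (False, s, s)"

lemma read_write_cell [simp]: "read_cell (write_cell z) = z"
  by (simp add: write_cell_def)

text \<open>A verdict \<open>OutOther\<close> carries no opinion, so it starts the rewind instead of
  halting.\<close>

fun first_control :: "control \<Rightarrow> control" where
  "first_control (Run q) = phase_state (First q)"
| "first_control (Halt OutOther) = phase_state Rewind"
| "first_control (Halt v) = Halt v"

fun second_control :: "control \<Rightarrow> control" where
  "second_control (Run q) = phase_state (Second q)"
| "second_control (Halt v) = Halt v"

definition orelse_states :: "tm \<Rightarrow> tm \<Rightarrow> phase set" where
  "orelse_states M N = {Init, Rewind} \<union> First ` states M \<union> Second ` states N"

text \<open>The raw symbols remain because unvisited cells still hold the input or a blank. They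
  cannot clash with coded cells, which are all of the form \<open>Aux n\<close>.\<close>

definition orelse_alphabet :: "tm \<Rightarrow> tm \<Rightarrow> symbol set" where
  "orelse_alphabet M N =
     {Blank, Bit False, Bit True} \<union> write_cell ` (UNIV \<times> alphabet M \<times> alphabet N)"

text \<open>A left move on the leftmost cell is invisible to a machine. Therefore
  \<open>Init\<close> first sets the mark there, and \<open>Rewind\<close> walks left until it reads
  the mark.\<close>

fun orelse_trans :: "tm \<Rightarrow> tm \<Rightarrow> phase \<Rightarrow> bool \<times> symbol \<times> symbol \<Rightarrow>
    control \<times> (bool \<times> symbol \<times> symbol) \<times> move" where
  "orelse_trans M N Init (m, a, b) = (phase_state (First (start M)), (True, a, b), Stay)"
| "orelse_trans M N (First q) (m, a, b) =
     (case trans M (q, a) of (c, a', d) \<Rightarrow> (first_control c, (m, a', b), d))"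
| "orelse_trans M N Rewind (m, a, b) =
     (if m then (phase_state (Second (start N)), (m, a, b), Stay)
      else (phase_state Rewind, (m, a, b), MoveLeft))"
| "orelse_trans M N (Second q) (m, a, b) =
     (case trans N (q, b) of (c, b', d) \<Rightarrow> (second_control c, (m, a, b'), d))"

definition orelse :: "tm \<Rightarrow> tm \<Rightarrow> tm" where
  "orelse M N =
     \<lparr>states = to_nat ` orelse_states M N, alphabet = orelse_alphabet M N, start = to_nat Init,
      trans = (\<lambda>(q, s) \<in> to_nat ` orelse_states M N \<times> orelse_alphabet M N.
        case orelse_trans M N (from_nat q) (read_cell s) of (c, z, d) \<Rightarrow> (c, write_cell z, d))\<rparr>"

section \<open>Well-formedness and running time of the composed machine\<close>

context
  fixes M N :: tm
  assumes M: "turing_machine M" and N: "turing_machine N"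
begin

text \<open>A raw symbol is read as itself on both tracks, and both alphabets contain the blank and
  the two bits.\<close>

lemma read_cell_in:
  assumes "s \<in> orelse_alphabet M N"
  shows "read_cell s \<in> UNIV \<times> alphabet M \<times> alphabet N"
  using assms M N by (auto simp: orelse_alphabet_def turing_machine_def)

lemma first_control_in:
  "c \<in> Run ` states M \<union> range Halt \<Longrightarrow>
    first_control c \<in> Run ` to_nat ` orelse_states M N \<union> range Halt"
  by (cases c rule: first_control.cases) (auto simp: orelse_states_def)

lemma second_control_in:
  "c \<in> Run ` states N \<union> range Halt \<Longrightarrow>
    second_control c \<in> Run ` to_nat ` orelse_states M N \<union> range Halt"
  by (cases c rule: second_control.cases) (auto simp: orelse_states_def)

lemma orelse_trans_in:
  assumes "p \<in> orelse_states M N" "z \<in> UNIV \<times> alphabet M \<times> alphabet N"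
  shows "orelse_trans M N p z \<in>
    (Run ` to_nat ` orelse_states M N \<union> range Halt) \<times> (UNIV \<times> alphabet M \<times> alphabet N) \<times> UNIV"
proof (cases "(M, N, p, z)" rule: orelse_trans.cases)
  case (1 _ _ m a b)
  then show ?thesis using assms M by (auto simp: orelse_states_def turing_machine_def)
next
  case (2 _ _ q m a b)
  then have "q \<in> states M" "a \<in> alphabet M"
    using assms by (auto simp: orelse_states_def)
  moreover obtain k s d where k: "trans M (q, a) = (k, s, d)"
    by (rule prod_cases3)
  ultimately have "k \<in> Run ` states M \<union> range Halt" "s \<in> alphabet M"
    using trans_in[OF M, of q a] by (simp_all only: mem_Times_iff fst_conv snd_conv)
  with 2 k show ?thesis
    using assms(2) first_control_in[of k] by (simp only: orelse_trans.simps prod.case) simp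
next
  case (3 _ _ m a b)
  then show ?thesis using assms N by (auto simp: orelse_states_def turing_machine_def)
next
  case (4 _ _ q m a b)
  then have "q \<in> states N" "b \<in> alphabet N"
    using assms by (auto simp: orelse_states_def)
  moreover obtain k s d where k: "trans N (q, b) = (k, s, d)"
    by (rule prod_cases3)
  ultimately have "k \<in> Run ` states N \<union> range Halt" "s \<in> alphabet N"
    using trans_in[OF N, of q b] by (simp_all only: mem_Times_iff fst_conv snd_conv)
  with 4 k show ?thesis
    using assms(2) second_control_in[of k] by (simp only: orelse_trans.simps prod.case) simp
qed

lemma turing_machine_orelse: "turing_machine (orelse M N)"
proof -
  have "(case orelse_trans M N p (read_cell s) of (c, z, d) \<Rightarrow> (c, write_cell z, d)) \<in>
      (Run ` to_nat ` orelse_states M N \<union> range Halt) \<times> orelse_alphabet M N \<times> UNIV"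
    if "p \<in> orelse_states M N" "s \<in> orelse_alphabet M N" for p s
    using orelse_trans_in[OF that(1) read_cell_in[OF that(2)]]
    by (auto simp: orelse_alphabet_def split: prod.split)
  then have "trans (orelse M N) \<in> states (orelse M N) \<times> alphabet (orelse M N) \<rightarrow>\<^sub>E
      (Run ` states (orelse M N) \<union> range Halt) \<times> alphabet (orelse M N) \<times> UNIV"
    by (auto simp: orelse_def intro!: restrict_PiE_iff[THEN iffD2])
  moreover have "finite (orelse_states M N)" "finite (orelse_alphabet M N)"
    using M N by (auto simp: orelse_states_def orelse_alphabet_def turing_machine_def)
  ultimately show ?thesis
    by (simp add: turing_machine_def orelse_def) (simp add: orelse_states_def orelse_alphabet_def)
qed

text \<open>Speaks of decoded cells, so raw and coded symbols may be mixed on the tape. Membership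
  in the alphabet keeps every step inside the domain to which \<open>trans\<close> is
  restricted.\<close>

definition two_track :: "(nat \<Rightarrow> symbol) \<Rightarrow> (nat \<Rightarrow> symbol) \<Rightarrow> (nat \<Rightarrow> symbol) \<Rightarrow> bool" where
  "two_track tp a b \<longleftrightarrow>
     (\<forall>j. tp j \<in> orelse_alphabet M N \<and> read_cell (tp j) = (j = 0, a j, b j))"

lemma step_orelse:
  assumes "p \<in> orelse_states M N" "tp i \<in> orelse_alphabet M N"
    and "orelse_trans M N p (read_cell (tp i)) = (c, z, d)"
  shows "step (orelse M N) (phase_state p, i, tp) = (c, move_head d i, tp(i := write_cell z))"
  using assms by (simp add: orelse_def)

lemma two_track_upd:
  assumes "two_track tp a b" "a' \<in> alphabet M" "b' \<in> alphabet N"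
  shows "two_track (tp(i := write_cell (i = 0, a', b'))) (a(i := a')) (b(i := b'))"
  using assms by (auto simp: two_track_def orelse_alphabet_def)

lemma two_track_in:
  assumes "two_track tp a b"
  shows "a j \<in> alphabet M" "b j \<in> alphabet N"
  using read_cell_in[of "tp j"] assms by (auto simp: two_track_def)

text \<open>The second track \<open>b\<close> is a fixed parameter: the run of the first machine
  must leave the copy of the input intact.\<close>

definition first_sim :: "(nat \<Rightarrow> symbol) \<Rightarrow> config \<Rightarrow> config \<Rightarrow> bool" where
  "first_sim b = (\<lambda>(c, i, a) (c', i', tp). c \<in> Run ` states M \<union> range Halt \<and>
     c' = first_control c \<and> i' = i \<and> two_track tp a b)"

text \<open>The first track is existentially quantified, as it holds whatever the first machine
  wrote.\<close>

definition second_sim :: "config \<Rightarrow> config \<Rightarrow> bool" where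
  "second_sim = (\<lambda>(c, i, b) (c', i', tp). c \<in> Run ` states N \<union> range Halt \<and>
     c' = second_control c \<and> i' = i \<and> (\<exists>a. two_track tp a b))"

lemma first_sim_step:
  assumes "first_sim b c d" "fst c = Run q"
  shows "first_sim b (step M c) (step (orelse M N) d)"
proof -
  obtain i a tp where c: "c = (Run q, i, a)" and d: "d = (phase_state (First q), i, tp)"
    and q: "q \<in> states M" and tp: "two_track tp a b"
    using assms by (cases c rule: prod_cases3) (auto simp: first_sim_def)
  obtain k s m where k: "trans M (q, a i) = (k, s, m)"
    by (rule prod_cases3)
  have k_in: "k \<in> Run ` states M \<union> range Halt" "s \<in> alphabet M"
    using trans_in[OF M q two_track_in(1)[OF tp]] k by (metis SigmaD1 SigmaD2)+
  have "step (orelse M N) d =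
      (first_control k, move_head m i, tp(i := write_cell (i = 0, s, b i)))"
    unfolding d using q tp k by (intro step_orelse) (auto simp: orelse_states_def two_track_def)
  moreover have "two_track (tp(i := write_cell (i = 0, s, b i))) (a(i := s)) b"
    using two_track_upd[OF tp k_in(2) two_track_in(2)[OF tp], of i i] by simp
  ultimately show ?thesis
    using k k_in by (simp add: c first_sim_def)
qed

lemma second_sim_step:
  assumes "second_sim c d" "fst c = Run q"
  shows "second_sim (step N c) (step (orelse M N) d)"
proof -
  obtain i a b tp where c: "c = (Run q, i, b)" and d: "d = (phase_state (Second q), i, tp)"
    and q: "q \<in> states N" and tp: "two_track tp a b"
    using assms by (cases c rule: prod_cases3) (auto simp: second_sim_def)
  obtain k s m where k: "trans N (q, b i) = (k, s, m)"
    by (rule prod_cases3)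
  have k_in: "k \<in> Run ` states N \<union> range Halt" "s \<in> alphabet N"
    using trans_in[OF N q two_track_in(2)[OF tp]] k by (metis SigmaD1 SigmaD2)+
  have "step (orelse M N) d =
      (second_control k, move_head m i, tp(i := write_cell (i = 0, a i, s)))"
    unfolding d using q tp k by (intro step_orelse) (auto simp: orelse_states_def two_track_def)
  moreover have "two_track (tp(i := write_cell (i = 0, a i, s))) a (b(i := s))"
    using two_track_upd[OF tp two_track_in(1)[OF tp] k_in(2), of i i] by simp
  ultimately show ?thesis
    using k k_in by (auto simp: c second_sim_def)
qed

text \<open>There are \<open>i\<close> moves to the left and one more step on the marked cell to
  enter the second machine. The tape may change to some \<open>tp'\<close>, since rewriting replaces
  raw symbols by coded cells with the same contents.\<close>

lemma rewind:
  assumes "two_track tp a b"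
  shows "\<exists>tp'. two_track tp' a b \<and> (step (orelse M N) ^^ Suc i) (phase_state Rewind, i, tp) =
    (phase_state (Second (start N)), 0, tp')"
  using assms
proof (induction i arbitrary: tp)
  case 0
  have "step (orelse M N) (phase_state Rewind, 0, tp) =
      (phase_state (Second (start N)), move_head Stay 0, tp(0 := write_cell (True, a 0, b 0)))"
    using 0 by (intro step_orelse) (auto simp: orelse_states_def two_track_def)
  moreover have "two_track (tp(0 := write_cell (True, a 0, b 0))) a b"
    using two_track_upd[OF 0 two_track_in[OF 0], of 0 0 0] by simp
  ultimately show ?case by auto
next
  case (Suc i)
  let ?tp = "tp(Suc i := write_cell (False, a (Suc i), b (Suc i)))"
  have "step (orelse M N) (phase_state Rewind, Suc i, tp) =
      (phase_state Rewind, move_head MoveLeft (Suc i), ?tp)"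
    using Suc.prems by (intro step_orelse) (auto simp: orelse_states_def two_track_def)
  moreover have "two_track ?tp a b"
    using two_track_upd[OF Suc.prems two_track_in[OF Suc.prems], of "Suc i" "Suc i" "Suc i"]
    by simp
  moreover have "(step (orelse M N) ^^ Suc (Suc i)) (phase_state Rewind, Suc i, tp) =
      (step (orelse M N) ^^ Suc i) (step (orelse M N) (phase_state Rewind, Suc i, tp))"
    by (simp only: funpow_Suc_right comp_apply)
  ultimately show ?case
    using Suc.IH[of ?tp] by (metis move_head.simps(1) diff_Suc_1)
qed

text \<open>The untouched input already reads as two equal tracks; the single step of
  \<open>Init\<close> supplies the missing mark on cell 0.\<close>

lemma init_step:
  "first_sim (snd (snd (initial N x))) (initial M x)
     (step (orelse M N) (initial (orelse M N) x))"
proof -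
  define a where "a j = (if j < length x then Bit (x ! j) else Blank)" for j
  have a: "a j \<in> {Blank, Bit False, Bit True}" for j
    by (cases "x ! j") (auto simp: a_def)
  have read_a: "read_cell (a j) = (False, a j, a j)" for j
    using a[of j] by auto
  have "step (orelse M N) (phase_state Init, 0, a) =
      (phase_state (First (start M)), move_head Stay 0, a(0 := write_cell (True, a 0, a 0)))"
    using a[of 0] by (intro step_orelse) (auto simp: orelse_states_def orelse_alphabet_def read_a)
  moreover have "a j \<in> orelse_alphabet M N" "a j \<in> alphabet M" "a j \<in> alphabet N" for j
    using a[of j] M N by (auto simp: orelse_alphabet_def turing_machine_def)
  then have "two_track (a(0 := write_cell (True, a 0, a 0))) a a"
    by (simp add: two_track_def read_a) (simp add: orelse_alphabet_def)
  moreover have "initial (orelse M N) x = (phase_state Init, 0, a)"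
    "initial M x = (Run (start M), 0, a)" "initial N x = (Run (start N), 0, a)"
    by (auto simp: initial_def orelse_def a_def)
  ultimately show ?thesis
    using M by (simp add: first_sim_def turing_machine_def)
qed

text \<open>The time bound adds 1 step for the mark, at most \<open>t\<close> for \<open>M\<close>,
  at most \<open>t + 1\<close> for the rewind, as the head of \<open>M\<close> is then at a position
  \<open>i \<le> t\<close>, and at most \<open>t'\<close> for \<open>N\<close>.\<close>

lemma halts_within_orelse:
  assumes "halts_within M x t u" "halts_within N x t' v"
  shows "halts_within (orelse M N) x (2 * t + t' + 2) (if u = OutOther then v else u)"
proof -
  let ?S = "step (orelse M N)" and ?b = "snd (snd (initial N x))"
  define d where "d = ?S (initial (orelse M N) x)"
  have d: "first_sim ?b (initial M x) d"
    using init_step by (simp add: d_def)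
  obtain t1 where t1: "t1 \<le> t" "first_sim ?b ((step M ^^ t) (initial M x)) ((?S ^^ t1) d)"
    using simulation_until_halt[of "first_sim ?b" M "orelse M N" "initial M x" d t u]
      first_sim_step d assms(1) unfolding halts_within_def by blast
  obtain i a where M_end: "(step M ^^ t) (initial M x) = (Halt u, i, a)"
    using assms(1) unfolding halts_within_def by (metis prod.collapse)
  then obtain tp where tp: "(?S ^^ t1) d = (first_control (Halt u), i, tp)" "two_track tp a ?b"
    using t1(2) by (auto simp: first_sim_def)
  then have run1: "(?S ^^ Suc t1) (initial (orelse M N) x) = (first_control (Halt u), i, tp)"
    by (simp add: d_def funpow_Suc_right del: funpow.simps)
  show ?thesis
  proof (cases "u = OutOther")
    case False
    then have "halts_within (orelse M N) x (Suc t1) u"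
      using run1 by (cases u) (auto simp: halts_within_def)
    then show ?thesis
      using False t1(1) halts_within_mono by fastforce
  next
    case True
    obtain tp' where tp': "two_track tp' a ?b"
      "(?S ^^ Suc i) (phase_state Rewind, i, tp) = (phase_state (Second (start N)), 0, tp')"
      using rewind[OF tp(2)] by blast
    let ?e = "(phase_state (Second (start N)), 0, tp')"
    \<comment> \<open>The second track is still the initial tape of \<open>N\<close> and the head is
      back at 0.\<close>
    have "second_sim (initial N x) ?e"
      using N tp'(1) by (auto simp: second_sim_def initial_def turing_machine_def)
    then obtain t2 where t2: "t2 \<le> t'" "second_sim ((step N ^^ t') (initial N x)) ((?S ^^ t2) ?e)"
      using simulation_until_halt[of second_sim N "orelse M N" "initial N x" ?e t' v]
        second_sim_step assms(2) unfolding halts_within_def by blast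
    have "fst ((?S ^^ t2) ?e) = Halt v"
      using t2(2) assms(2) by (auto simp: second_sim_def halts_within_def split: prod.splits)
    moreover have "(?S ^^ (t2 + (Suc i + Suc t1))) (initial (orelse M N) x) = (?S ^^ t2) ?e"
      using run1 tp'(2) True by (simp only: funpow_add comp_apply first_control.simps)
    ultimately have "halts_within (orelse M N) x (t2 + (Suc i + Suc t1)) v"
      unfolding halts_within_def by simp
    moreover have "i \<le> t"
      using head_le[where c = "initial M x" and t = t and M = M] M_end by (simp add: initial_def)
    ultimately show ?thesis
      using True t1(1) t2(1) halts_within_mono by fastforce
  qed
qed

end

section \<open>The family of slices\<close>

lemma P_slice_subset_words: "P_slice A S \<Longrightarrow> S \<subseteq> words"
  by (auto simp: P_slice_def tm_dom_def)

text \<open>A machine that halts at once without an opinion approximates every set.\<close>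

lemma P_slice_empty: "P_slice A {}"
proof -
  define M :: tm where "M = \<lparr>states = {0}, alphabet = {Blank, Bit False, Bit True}, start = 0,
    trans = (\<lambda>_ \<in> {0} \<times> {Blank, Bit False, Bit True}. (Halt OutOther, Blank, Stay))\<rparr>"
  have M: "turing_machine M"
    by (auto simp: turing_machine_def M_def)
  have "halts_within M x 1 OutOther" for x
    \<comment> \<open>The cases settle which symbol is scanned on cell 0: a blank or one of the two
      bits.\<close>
    by (cases "x = []"; cases "x ! 0") (auto simp: halts_within_def initial_def M_def)
  then have halts: "halts_within M x (poly [:1:] (length x)) OutOther" for x
    by simp
  then have "polynomial_time M"
    unfolding polynomial_time_def by blast
  moreover have "outputs M x v \<longleftrightarrow> v = OutOther" for x v
    using outputs_eqI[OF halts] .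
  ultimately have "P_approximation M A" "tm_dom M = {}"
    using M by (auto simp: P_approximation_def partial_decision_procedure_def tm_dom_def)
  then show ?thesis
    unfolding P_slice_def by blast
qed

text \<open>Both machines are correct for the same \<open>A\<close>, so whichever of them answers,
  the answer is right; the composition is undecided exactly where both are.\<close>

lemma P_slice_Un:
  assumes "P_slice A S" "P_slice A T"
  shows "P_slice A (S \<union> T)"
proof -
  obtain M where M: "P_approximation M A" "S = tm_dom M"
    using assms(1) unfolding P_slice_def by blast
  obtain N where N: "P_approximation N A" "T = tm_dom N"
    using assms(2) unfolding P_slice_def by blast
  have tms: "turing_machine M" "turing_machine N"
    using M(1) N(1) by (auto simp: P_approximation_def partial_decision_procedure_def)
  obtain p where "\<forall>x\<in>words. \<exists>v. halts_within M x (poly p (length x)) v"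
    using M(1) unfolding P_approximation_def polynomial_time_def by blast
  then obtain u where u: "\<And>x. x \<in> words \<Longrightarrow> halts_within M x (poly p (length x)) (u x)"
    by metis
  obtain r where "\<forall>x\<in>words. \<exists>v. halts_within N x (poly r (length x)) v"
    using N(1) unfolding P_approximation_def polynomial_time_def by blast
  then obtain v where v: "\<And>x. x \<in> words \<Longrightarrow> halts_within N x (poly r (length x)) (v x)"
    by metis
  let ?w = "\<lambda>x. if u x = OutOther then v x else u x"
  \<comment> \<open>The polynomial instantiates the bound \<open>2 * t + t' + 2\<close> with
    \<open>p\<close> for \<open>t\<close> and \<open>r\<close> for \<open>t'\<close>.\<close>
  have w: "halts_within (orelse M N) x (poly (p + p + r + [:2:]) (length x)) (?w x)"
    if "x \<in> words" for x
    using halts_within_orelse[OF tms u[OF that] v[OF that]] by (simp add: mult_2)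
  have out: "outputs M x y \<longleftrightarrow> y = u x" "outputs N x y \<longleftrightarrow> y = v x"
    "outputs (orelse M N) x y \<longleftrightarrow> y = ?w x" if "x \<in> words" for x y
    using outputs_eqI[OF u[OF that]] outputs_eqI[OF v[OF that]] outputs_eqI[OF w[OF that]] by blast+
  have "partial_decision_procedure (orelse M N) A"
    using M(1) N(1) turing_machine_orelse[OF tms]
    by (auto simp: P_approximation_def partial_decision_procedure_def out)
  moreover have "polynomial_time (orelse M N)"
    unfolding polynomial_time_def using w by blast
  moreover have "tm_dom (orelse M N) = S \<union> T"
  proof -
    have "x \<in> tm_dom (orelse M N) \<longleftrightarrow> x \<in> S \<union> T" for x
      by (cases "u x") (auto simp: tm_dom_def M(2) N(2) out)
    then show ?thesis by blast
  qed
  ultimately show ?thesis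
    unfolding P_slice_def P_approximation_def by metis
qed

theorem theorem1:
  fixes A :: "bool list set"
  assumes "A \<subseteq> words"
  shows "(\<exists>S. maximal_P_slice A S) \<longleftrightarrow> (\<exists>C. maximal_P_core A C)"
proof -
  have "{S. P_slice A S} \<noteq> {}"
    using P_slice_empty by blast
  from ex_almost_greatest_iff_ex_almost_greatest_orthogonal[OF countable_P_slices this, of words]
  show ?thesis
    using P_slice_Un P_slice_subset_words
    by (simp add: maximal_P_slice_def maximal_P_core_def P_core_def)
qed

end
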